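(* Let $M$ be an oriented surface in $\mathbb{E}^3$, let $\gamma: I\subset\mathbb{R}\to M$ be a regular curve with arc-length parametrization, and let $D_r$ be the rectifying Darboux vector field of $\gamma$. Then $\gamma$ is a relatively normal-slant helix if and only if the integral curve of the rectifying Darboux vector field $D_r$ is a circular helix.
   Context: $\mathbb{E}^3$ is Euclidean 3-space. For a unit speed curve $\gamma$ (with arc-length parameter $s$) on an oriented surface $M\subset\mathbb{E}^3$, the Darboux frame along $\gamma$ is $\{\mathsf{T},\mathsf{V},\mathsf{U}\}$, where $\mathsf{T}=\gamma'$ is the unit tangent vector field of $\gamma$, $\mathsf{U}$ is the unit normal vector field of $M$ restricted to $\gamma$, and $\mathsf{V}=\mathsf{U}\times\mathsf{T}$. The geodesic curvature $\kappa_g$, normal curvature $\kappa_n$ and geodesic torsion $\tau_g$ of $\gamma$ are given by $$\mathsf{T}'=\kappa_g\mathsf{V}+\kappa_n\mathsf{U},\quad \mathsf{V}'=-\kappa_g\mathsf{T}+\tau_g\mathsf{U},\quad \mathsf{U}'=-\kappa_n\mathsf{T}-\tau_g\mathsf{V}.$$ The curve $\gamma$ is called a relatively normal-slant helix if its vector field $\mathsf{V}$ makes a constant angle with a fixed direction, i.e. there exist a fixed unit vector $d$ and a constant angle $\theta$ such that $\langle\mathsf{V},d\rangle=\cos\theta$ along $\gamma$. The rectifying Darboux vector field along $\gamma$ is $D_r(s)=\tau_g(s)\mathsf{T}(s)+\kappa_g(s)\mathsf{U}(s)$. The integral curve of $D_r$ is the curve $\beta$ with $\beta'(s)=D_r(s)$.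 A circular helix is a space curve with constant curvature and constant torsion.
   Formalization: It is additionally assumed that D_r vanishes nowhere, so that its integral curve is regular (for a great circle on a sphere, D_r = 0 and the integral curve is a point); straight lines count as circular helices, with curvature and torsion 0. *)

theory Defs
  imports "HOL-Analysis.Analysis"
begin

unbundle cross3_syntax

section \<open>Smooth maps\<close>

text \<open>Iterated directional derivatives; both predicates are meant for open sets \<open>S\<close>.
  Membership in \<open>Ck_on k\<close> amounts to being k times continuously differentiable when the
  domain is finite-dimensional.\<close>

primrec Ck_on :: "nat \<Rightarrow> ('a::real_normed_vector \<Rightarrow> 'b::real_normed_vector) \<Rightarrow> 'a set \<Rightarrow> bool" where
  "Ck_on 0 f S \<longleftrightarrow> continuous_on S f"
| "Ck_on (Suc k) f S \<longleftrightarrow>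
     (\<forall>x\<in>S. f differentiable (at x)) \<and> (\<forall>v. Ck_on k (\<lambda>x. frechet_derivative f (at x) v) S)"

definition smooth_on :: "'a set \<Rightarrow> ('a::real_normed_vector \<Rightarrow> 'b::real_normed_vector) \<Rightarrow> bool" where
  "smooth_on S f \<longleftrightarrow> (\<forall>k. Ck_on k f S)"

section \<open>Space curves\<close>

definition vderiv :: "(real \<Rightarrow> 'a::real_normed_vector) \<Rightarrow> real \<Rightarrow> 'a" where
  "vderiv f s = vector_derivative f (at s)"

text \<open>Curves are parametrized over open intervals \<open>I\<close>, so two-sided derivatives suffice.\<close>

definition regular_curve_on :: "real set \<Rightarrow> (real \<Rightarrow> real^3) \<Rightarrow> bool" where
  "regular_curve_on I c \<longleftrightarrow> smooth_on I c \<and> (\<forall>s\<in>I. vderiv c s \<noteq> 0)"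

definition unit_speed_on :: "real set \<Rightarrow> (real \<Rightarrow> real^3) \<Rightarrow> bool" where
  "unit_speed_on I c \<longleftrightarrow> (\<forall>s\<in>I. norm (vderiv c s) = 1)"

text \<open>Curvature and torsion of a regular curve that need not have unit speed. Where the
  curvature vanishes the Frenet frame does not exist, and \<open>x / 0 = 0\<close> makes the torsion \<open>0\<close>;
  in particular straight lines have curvature and torsion \<open>0\<close>.\<close>

definition curvature :: "(real \<Rightarrow> real^3) \<Rightarrow> real \<Rightarrow> real" where
  "curvature c s = norm (vderiv c s \<times> vderiv (vderiv c) s) / norm (vderiv c s) ^ 3"

definition torsion :: "(real \<Rightarrow> real^3) \<Rightarrow> real \<Rightarrow> real" where
  "torsion c s =
     ((vderiv c s \<times> vderiv (vderiv c) s) \<bullet> vderiv (vderiv (vderiv c)) s)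
       / (norm (vderiv c s \<times> vderiv (vderiv c) s))\<^sup>2"

text \<open>Straight lines are admitted as degenerate circular helices.\<close>

definition circular_helix_on :: "real set \<Rightarrow> (real \<Rightarrow> real^3) \<Rightarrow> bool" where
  "circular_helix_on I c \<longleftrightarrow>
     regular_curve_on I c \<and>
     (\<exists>k. \<forall>s\<in>I. curvature c s = k) \<and> (\<exists>t. \<forall>s\<in>I. torsion c s = t)"

section \<open>Oriented surfaces in Euclidean 3-space\<close>

definition regular_surface :: "(real^3) set \<Rightarrow> bool" where
  "regular_surface M \<longleftrightarrow>
     (\<forall>p\<in>M. \<exists>W D (x :: real^2 \<Rightarrow> real^3) y.
        open W \<and> p \<in> W \<and> open D \<and> homeomorphism D (M \<inter> W) x y \<and>
        smooth_on D x \<and> (\<forall>q\<in>D. inj (frechet_derivative x (at q))))"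

definition tangent_plane :: "(real^3) set \<Rightarrow> real^3 \<Rightarrow> (real^3) set" where
  "tangent_plane M p =
     {vderiv c s | c s. \<exists>J. open J \<and> is_interval J \<and> s \<in> J \<and> smooth_on J c \<and> c ` J \<subseteq> M \<and> c s = p}"

text \<open>The orientation of \<open>M\<close> is the choice of a smooth unit normal field \<open>N\<close>; smoothness of a map
  on \<open>M\<close> means having local smooth extensions to open subsets of the ambient space. The values
  of \<open>N\<close> off \<open>M\<close> are irrelevant.\<close>

definition oriented_surface :: "(real^3) set \<Rightarrow> (real^3 \<Rightarrow> real^3) \<Rightarrow> bool" where
  "oriented_surface M N \<longleftrightarrow>
     regular_surface M \<and>
     (\<forall>p\<in>M. norm (N p) = 1 \<and> (\<forall>v \<in> tangent_plane M p. N p \<bullet> v = 0)) \<and>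
     (\<forall>p\<in>M. \<exists>W F. open W \<and> p \<in> W \<and> smooth_on W F \<and> (\<forall>q \<in> M \<inter> W. F q = N q))"

section \<open>The Darboux frame\<close>

definition darboux_T :: "(real \<Rightarrow> real^3) \<Rightarrow> real \<Rightarrow> real^3" where
  "darboux_T \<gamma> = vderiv \<gamma>"

definition darboux_U :: "(real^3 \<Rightarrow> real^3) \<Rightarrow> (real \<Rightarrow> real^3) \<Rightarrow> real \<Rightarrow> real^3" where
  "darboux_U N \<gamma> s = N (\<gamma> s)"

definition darboux_V :: "(real^3 \<Rightarrow> real^3) \<Rightarrow> (real \<Rightarrow> real^3) \<Rightarrow> real \<Rightarrow> real^3" where
  "darboux_V N \<gamma> s = darboux_U N \<gamma> s \<times> darboux_T \<gamma> s"

text \<open>The coefficients in the Darboux equations, read off from the orthonormal frame; the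
  equations themselves are the lemma \<open>darboux_equations\<close> below.\<close>

definition geodesic_curvature :: "(real^3 \<Rightarrow> real^3) \<Rightarrow> (real \<Rightarrow> real^3) \<Rightarrow> real \<Rightarrow> real" where
  "geodesic_curvature N \<gamma> s = vderiv (darboux_T \<gamma>) s \<bullet> darboux_V N \<gamma> s"

definition normal_curvature :: "(real^3 \<Rightarrow> real^3) \<Rightarrow> (real \<Rightarrow> real^3) \<Rightarrow> real \<Rightarrow> real" where
  "normal_curvature N \<gamma> s = vderiv (darboux_T \<gamma>) s \<bullet> darboux_U N \<gamma> s"

definition geodesic_torsion :: "(real^3 \<Rightarrow> real^3) \<Rightarrow> (real \<Rightarrow> real^3) \<Rightarrow> real \<Rightarrow> real" where
  "geodesic_torsion N \<gamma> s = vderiv (darboux_V N \<gamma>) s \<bullet> darboux_U N \<gamma> s"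

definition rectifying_darboux :: "(real^3 \<Rightarrow> real^3) \<Rightarrow> (real \<Rightarrow> real^3) \<Rightarrow> real \<Rightarrow> real^3" where
  "rectifying_darboux N \<gamma> s =
     geodesic_torsion N \<gamma> s *\<^sub>R darboux_T \<gamma> s + geodesic_curvature N \<gamma> s *\<^sub>R darboux_U N \<gamma> s"

definition relatively_normal_slant_helix ::
  "real set \<Rightarrow> (real^3 \<Rightarrow> real^3) \<Rightarrow> (real \<Rightarrow> real^3) \<Rightarrow> bool" where
  "relatively_normal_slant_helix I N \<gamma> \<longleftrightarrow>
     (\<exists>d \<theta>. norm d = 1 \<and> (\<forall>s\<in>I. darboux_V N \<gamma> s \<bullet> d = cos \<theta>))"

section \<open>The Darboux equations\<close>

lemma vderiv_works: "f differentiable (at s) \<Longrightarrow> (f has_vector_derivative vderiv f s) (at s)"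
  by (simp add: vderiv_def vector_derivative_works)

lemma vderiv_eqI: "(f has_vector_derivative f') (at s) \<Longrightarrow> vderiv f s = f'"
  by (simp add: vderiv_def vector_derivative_at)

lemma smooth_on_differentiable: "smooth_on S f \<Longrightarrow> x \<in> S \<Longrightarrow> f differentiable (at x)"
  unfolding smooth_on_def by (metis Ck_on.simps(2))

lemma smooth_on_vderiv_differentiable:
  assumes "smooth_on I f" "open I" "s \<in> I"
  shows "vderiv f differentiable (at s)"
proof -
  have "Ck_on (Suc (Suc 0)) f I"
    using assms(1) by (simp only: smooth_on_def)
  then have "(\<lambda>x. frechet_derivative f (at x) 1) differentiable (at s)"
    using assms(3) by simp
  then obtain D where D: "((\<lambda>x. frechet_derivative f (at x) 1) has_derivative D) (at s)"
    by (auto simp: differentiable_def)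
  have "(vderiv f has_derivative D) (at s)"
  proof (rule has_derivative_transform_within_open[OF D assms(2,3)])
    fix x assume "x \<in> I"
    then have "f differentiable (at x)"
      using assms(1) smooth_on_differentiable by blast
    then show "frechet_derivative f (at x) 1 = vderiv f x"
      by (simp add: vderiv_def frechet_derivative_eq_vector_derivative)
  qed
  then show ?thesis
    by (auto simp: differentiable_def)
qed

lemma orthonormal_frame_expand:
  fixes t u x :: "real^3"
  assumes "norm t = 1" "norm u = 1" "u \<bullet> t = 0"
  shows "norm (u \<times> t) = 1"
    and "x = (x \<bullet> t) *\<^sub>R t + (x \<bullet> (u \<times> t)) *\<^sub>R (u \<times> t) + (x \<bullet> u) *\<^sub>R u"
proof -
  define v where "v = u \<times> t"
  have "(norm v)\<^sup>2 = 1"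
    using norm_cross_dot[of u t] assms unfolding v_def by simp
  then have nv: "norm v = 1"
    by (metis norm_ge_zero one_power2 power2_eq_imp_eq zero_le_one)
  then show "norm (u \<times> t) = 1"
    by (simp add: v_def)
  have dots: "t \<bullet> t = 1" "u \<bullet> u = 1" "v \<bullet> v = 1" "u \<bullet> t = 0" "t \<bullet> u = 0"
      "v \<bullet> t = 0" "t \<bullet> v = 0" "v \<bullet> u = 0" "u \<bullet> v = 0"
    using assms nv by (auto simp: v_def dot_cross_self inner_commute norm_eq_1)
  have neq: "t \<noteq> u" "t \<noteq> v" "u \<noteq> v"
    using dots by auto
  have "pairwise orthogonal {t, u, v}" "0 \<notin> {t, u, v}"
    using dots by (auto simp: pairwise_def orthogonal_def)
  then have ind: "independent {t, u, v}"
    by (rule pairwise_orthogonal_independent)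
  have "card {t, u, v} = DIM(real^3)"
    using neq by simp
  with ind have sp: "UNIV \<subseteq> span {t, u, v}"
    by (intro card_ge_dim_independent) (auto simp: dim_UNIV)
  define y where "y = x - ((x \<bullet> t) *\<^sub>R t + (x \<bullet> v) *\<^sub>R v + (x \<bullet> u) *\<^sub>R u)"
  have "orthogonal y z" if "z \<in> {t, u, v}" for z
    using that dots by (auto simp: y_def orthogonal_def inner_simps)
  then have "orthogonal y y"
    using orthogonal_to_span[of y "{t, u, v}" y] sp by blast
  then show "x = (x \<bullet> t) *\<^sub>R t + (x \<bullet> (u \<times> t)) *\<^sub>R (u \<times> t) + (x \<bullet> u) *\<^sub>R u"
    by (simp add: y_def v_def orthogonal_self)
qed

lemma inner_derivative_of_constant:
  fixes f g :: "real \<Rightarrow> real^3"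
  assumes "f differentiable (at s)" "g differentiable (at s)"
    and "open I" "s \<in> I" "\<And>x. x \<in> I \<Longrightarrow> f x \<bullet> g x = c"
  shows "vderiv f s \<bullet> g s = - (f s \<bullet> vderiv g s)"
proof -
  have "((\<lambda>x. f x \<bullet> g x) has_vector_derivative (f s \<bullet> vderiv g s + vderiv f s \<bullet> g s)) (at s)"
    using bounded_bilinear.has_vector_derivative[OF bounded_bilinear_inner
        vderiv_works[OF assms(1)] vderiv_works[OF assms(2)]] .
  then have "((\<lambda>x. c) has_vector_derivative (f s \<bullet> vderiv g s + vderiv f s \<bullet> g s)) (at s)"
    by (rule has_vector_derivative_transform_within_open[OF _ assms(3,4)]) (use assms(5) in auto)
  then have "f s \<bullet> vderiv g s + vderiv f s \<bullet> g s = 0"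
    using has_vector_derivative_const vector_derivative_unique_at by blast
  then show ?thesis
    by simp
qed

lemma darboux_equations:
  assumes surf: "oriented_surface M N" and I: "open I" "is_interval I"
    and \<gamma>: "regular_curve_on I \<gamma>" "unit_speed_on I \<gamma>" "\<gamma> ` I \<subseteq> M" and s: "s \<in> I"
  defines "kg \<equiv> geodesic_curvature N \<gamma> s" and "kn \<equiv> normal_curvature N \<gamma> s"
    and "tg \<equiv> geodesic_torsion N \<gamma> s"
  shows "(darboux_T \<gamma> has_vector_derivative kg *\<^sub>R darboux_V N \<gamma> s + kn *\<^sub>R darboux_U N \<gamma> s) (at s)"
    and "(darboux_V N \<gamma> has_vector_derivative - kg *\<^sub>R darboux_T \<gamma> s + tg *\<^sub>R darboux_U N \<gamma> s) (at s)"
    and "(darboux_U N \<gamma> has_vector_derivative - kn *\<^sub>R darboux_T \<gamma> s - tg *\<^sub>R darboux_V N \<gamma> s) (at s)"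
proof -
  let ?T = "darboux_T \<gamma>" and ?U = "darboux_U N \<gamma>" and ?V = "darboux_V N \<gamma>"
  have sm: "smooth_on I \<gamma>"
    using \<gamma>(1) by (simp add: regular_curve_on_def)
  have nT: "norm (?T x) = 1" if "x \<in> I" for x
    using \<gamma>(2) that by (simp add: unit_speed_on_def darboux_T_def)
  have nU: "norm (?U x) = 1" if "x \<in> I" for x
    using surf \<gamma>(3) that by (auto simp: oriented_surface_def darboux_U_def)
  have UT: "?U x \<bullet> ?T x = 0" if "x \<in> I" for x
  proof -
    have "vderiv \<gamma> x \<in> tangent_plane M (\<gamma> x)"
      using I sm \<gamma>(3) that unfolding tangent_plane_def by blast
    then show ?thesis
      using surf \<gamma>(3) that by (auto simp: oriented_surface_def darboux_T_def darboux_U_def)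
  qed
  have nV: "norm (?V x) = 1" if "x \<in> I" for x
    using orthonormal_frame_expand(1)[OF nT nU UT, OF that that that] by (simp add: darboux_V_def)
  have VT: "?V x \<bullet> ?T x = 0" and VU: "?V x \<bullet> ?U x = 0" for x
    by (simp_all add: darboux_V_def dot_cross_self)
  have dT: "?T differentiable (at s)"
    using smooth_on_vderiv_differentiable[OF sm I(1) s] by (simp add: darboux_T_def)
  have d\<gamma>: "\<gamma> differentiable (at s)"
    using sm s smooth_on_differentiable by blast
  have dU: "?U differentiable (at s)"
  proof -
    have "\<gamma> s \<in> M"
      using \<gamma>(3) s by blast
    then obtain W F where W: "open W" "\<gamma> s \<in> W" "smooth_on W F" "\<forall>q \<in> M \<inter> W. F q = N q"
      using surf unfolding oriented_surface_def by meson
    have "continuous_on I \<gamma>"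
      using sm unfolding smooth_on_def by (metis Ck_on.simps(1))
    then have op: "open (\<gamma> -` W \<inter> I)"
      using I(1) W(1) continuous_on_open_vimage by blast
    have "F differentiable (at (\<gamma> s))"
      using W smooth_on_differentiable by blast
    then have "(F \<circ> \<gamma>) differentiable (at s)"
      using d\<gamma> differentiable_chain_at by blast
    then obtain D where D: "((F \<circ> \<gamma>) has_derivative D) (at s)"
      by (auto simp: differentiable_def)
    have "(?U has_derivative D) (at s)"
      by (rule has_derivative_transform_within_open[OF D op])
        (use W \<gamma>(3) s in \<open>auto simp: darboux_U_def\<close>)
    then show ?thesis
      by (auto simp: differentiable_def)
  qed
  have bil: "bounded_bilinear ((\<times>) :: real^3 \<Rightarrow> real^3 \<Rightarrow> real^3)"
    using bilinear_cross bilinear_conv_bounded_bilinear by blast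
  have dV: "?V differentiable (at s)"
    using bounded_bilinear.has_vector_derivative[OF bil vderiv_works[OF dU] vderiv_works[OF dT]]
    unfolding darboux_V_def[abs_def] by (rule differentiableI_vector)
  note con = inner_derivative_of_constant[OF _ _ I(1) s]
  have TT: "vderiv ?T s \<bullet> ?T s = 0"
    using con[OF dT dT, of 1] nT by (simp add: norm_eq_1 inner_commute)
  have UU: "vderiv ?U s \<bullet> ?U s = 0"
    using con[OF dU dU, of 1] nU by (simp add: norm_eq_1 inner_commute)
  have VV: "vderiv ?V s \<bullet> ?V s = 0"
    using con[OF dV dV, of 1] nV by (simp add: norm_eq_1 inner_commute)
  have VT': "vderiv ?V s \<bullet> ?T s = - kg"
    using con[OF dV dT, of 0] VT by (simp add: kg_def geodesic_curvature_def inner_commute)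
  have UT': "vderiv ?U s \<bullet> ?T s = - kn"
    using con[OF dU dT, of 0] UT by (simp add: kn_def normal_curvature_def inner_commute)
  have UV': "vderiv ?U s \<bullet> ?V s = - tg"
    using con[OF dU dV, of 0] VU by (simp add: tg_def geodesic_torsion_def inner_commute)
  note ex = orthonormal_frame_expand(2)[OF nT[OF s] nU[OF s] UT[OF s], folded darboux_V_def]
  have "vderiv ?T s = kg *\<^sub>R ?V s + kn *\<^sub>R ?U s"
    using ex[of "vderiv ?T s"] TT by (simp add: kg_def kn_def geodesic_curvature_def normal_curvature_def)
  then show "(?T has_vector_derivative kg *\<^sub>R ?V s + kn *\<^sub>R ?U s) (at s)"
    using vderiv_works[OF dT] by simp
  have "vderiv ?V s = - kg *\<^sub>R ?T s + tg *\<^sub>R ?U s"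
    using ex[of "vderiv ?V s"] VV VT' by (simp add: tg_def geodesic_torsion_def)
  then show "(?V has_vector_derivative - kg *\<^sub>R ?T s + tg *\<^sub>R ?U s) (at s)"
    using vderiv_works[OF dV] by simp
  have "vderiv ?U s = - kn *\<^sub>R ?T s - tg *\<^sub>R ?V s"
    using ex[of "vderiv ?U s"] UU UT' UV' by simp
  then show "(?U has_vector_derivative - kn *\<^sub>R ?T s - tg *\<^sub>R ?V s) (at s)"
    using vderiv_works[OF dU] by simp
qed

end

theory Submission
  imports Defs
begin

text \<open>Only the vector field \<open>V\<close> of the Darboux frame matters. Since
  \<open>V' = - \<kappa>\<^sub>g T + \<tau>\<^sub>g U\<close>, the rectifying Darboux field is \<open>V \<times> V'\<close>. As this
  is nonzero, \<open>V\<close> traces a regular curve on the unit sphere, and \<open>\<beta>\<close> is a primitive of \<open>V \<times> V'\<close>. The theorem becomes a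
  statement about spherical curves, in which the spherical geodesic curvature
  \<open>k = det (V, V', V'') / |V'|^3\<close> is the common quantity:

  \<^item> \<open>V\<close> makes a constant angle with a fixed direction, that is, runs on a circle of the sphere,
    iff \<open>k\<close> is constant. With the unit conormal \<open>E = (V \<times> V') / |V'|\<close> one has \<open>E' = - k V'\<close>.
    If \<open>k\<close> is constant, then \<open>k V + E\<close> is a constant vector, the axis. Conversely a fixed
    direction \<open>d\<close> orthogonal to \<open>V'\<close> is \<open>c V + e E\<close> with constant \<open>c\<close> and \<open>e\<close>, and differentiating
    this gives \<open>c = e k\<close> (lemmas \<open>constant_curvature_imp_constant_angle\<close> and
    \<open>constant_angle_imp_constant_curvature\<close>).

  \<^item> \<open>\<beta>\<close> has curvature \<open>|k|\<close>, and its torsion is \<open>1\<close> wherever \<open>k \<noteq> 0\<close>: the binormal of \<open>\<beta>\<close> is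
    \<open>\<plusminus>V\<close>, which turns as fast as \<open>\<beta>\<close> moves. So \<open>\<beta>\<close> is a circular helix iff \<open>|k|\<close> is constant, and
    then \<open>k\<close> is constant too, because it is continuous on an interval (lemma
    \<open>primitive_circular_helix_iff\<close>). For \<open>k = 0\<close>, when \<open>V\<close> runs on a great circle, \<open>\<beta>\<close> is a straight
    line, which counts as a degenerate helix.

  A circular helix is required to be smooth, hence the calculus of smooth maps: the
  smoothness of \<open>V\<close> comes from that of the unit normal field restricted to the curve, which is
  locally a composition of smooth maps.\<close>

section \<open>Calculus of smooth maps\<close>

lemma Ck_on_Suc_has_derivative:
  "Ck_on (Suc k) f S \<Longrightarrow> x \<in> S \<Longrightarrow> (f has_derivative frechet_derivative f (at x)) (at x)"
  by (simp add: frechet_derivative_works)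

lemma Ck_on_cong:
  assumes "open S" "\<And>x. x \<in> S \<Longrightarrow> f x = g x" "Ck_on k f S"
  shows "Ck_on k g S"
  using assms(2,3)
proof (induction k arbitrary: f g)
  case 0
  then show ?case
    by (simp cong: continuous_on_cong)
next
  case (Suc k)
  have D: "(g has_derivative frechet_derivative f (at x)) (at x)" if "x \<in> S" for x
    by (rule has_derivative_transform_within_open
        [OF Ck_on_Suc_has_derivative[OF Suc.prems(2) that] \<open>open S\<close> that])
      (use Suc.prems(1) in auto)
  have "frechet_derivative f (at x) v = frechet_derivative g (at x) v" if "x \<in> S" for x v
    using frechet_derivative_at[OF D[OF that]] by simp
  then have "Ck_on k (\<lambda>x. frechet_derivative g (at x) v) S" for v
    using Suc.IH[of "\<lambda>x. frechet_derivative f (at x) v"] Suc.prems(2) by simp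
  then show ?case
    using D by (auto simp: differentiable_def)
qed

text \<open>Closure of \<open>Ck_on k\<close> under an operation goes by induction on \<open>k\<close>; in the step one only has
  to exhibit a derivative, which this rule then identifies with \<open>frechet_derivative\<close>.\<close>

lemma Ck_on_SucI:
  assumes "open S" "\<And>x. x \<in> S \<Longrightarrow> (f has_derivative f' x) (at x)"
    and "\<And>v. Ck_on k (\<lambda>x. f' x v) S"
  shows "Ck_on (Suc k) f S"
proof -
  have "f' x v = frechet_derivative f (at x) v" if "x \<in> S" for x v
    using frechet_derivative_at[OF assms(2)[OF that]] by simp
  then have "Ck_on k (\<lambda>x. frechet_derivative f (at x) v) S" for v
    using Ck_on_cong[OF assms(1) _ assms(3)[of v]] by simp
  then show ?thesis
    using assms(2) by (auto simp: differentiable_def)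
qed

lemma Ck_on_SucD: "Ck_on (Suc k) f S \<Longrightarrow> Ck_on k f S"
proof (induction k arbitrary: f)
  case 0
  then show ?case
    by (auto intro!: continuous_at_imp_continuous_on differentiable_imp_continuous_within)
qed simp

lemma Ck_on_const: "open S \<Longrightarrow> Ck_on k (\<lambda>x. c) S"
proof (induction k arbitrary: c)
  case (Suc k)
  show ?case
    by (rule Ck_on_SucI[where f' = "\<lambda>_ _. 0"]) (use Suc in auto)
qed simp

lemma Ck_on_linear:
  assumes "bounded_linear L" "open S"
  shows "Ck_on k f S \<Longrightarrow> Ck_on k (\<lambda>x. L (f x)) S"
proof (induction k arbitrary: f)
  case 0
  then show ?case
    using bounded_linear.continuous_on[OF assms(1)] by simp
next
  case (Suc k)
  show ?case
  proof (rule Ck_on_SucI[OF assms(2)])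
    show "((\<lambda>x. L (f x)) has_derivative (\<lambda>v. L (frechet_derivative f (at x) v))) (at x)"
      if "x \<in> S" for x
      using bounded_linear.has_derivative[OF assms(1)]
        Ck_on_Suc_has_derivative[OF Suc.prems that] by blast
    show "Ck_on k (\<lambda>x. L (frechet_derivative f (at x) v)) S" for v
      using Suc by simp
  qed
qed

lemma Ck_on_add:
  assumes "open S"
  shows "Ck_on k f S \<Longrightarrow> Ck_on k g S \<Longrightarrow> Ck_on k (\<lambda>x. f x + g x) S"
proof (induction k arbitrary: f g)
  case 0
  then show ?case
    by (simp add: continuous_on_add)
next
  case (Suc k)
  show ?case
  proof (rule Ck_on_SucI[OF assms])
    show "((\<lambda>x. f x + g x) has_derivative
        (\<lambda>v. frechet_derivative f (at x) v + frechet_derivative g (at x) v)) (at x)"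
      if "x \<in> S" for x
      using has_derivative_add Ck_on_Suc_has_derivative Suc.prems that by blast
    show "Ck_on k (\<lambda>x. frechet_derivative f (at x) v + frechet_derivative g (at x) v) S" for v
      using Suc by simp
  qed
qed

lemma Ck_on_sum:
  assumes "open S" "finite A" "\<And>i. i \<in> A \<Longrightarrow> Ck_on k (f i) S"
  shows "Ck_on k (\<lambda>x. \<Sum>i\<in>A. f i x) S"
  using assms(2,3)
  by (induction A rule: finite_induct) (auto intro: Ck_on_const Ck_on_add assms(1))

lemma Ck_on_bilinear:
  assumes "bounded_bilinear B" "open S"
  shows "Ck_on k f S \<Longrightarrow> Ck_on k g S \<Longrightarrow> Ck_on k (\<lambda>x. B (f x) (g x)) S"
proof (induction k arbitrary: f g)
  case 0
  then show ?case
    using bounded_bilinear.continuous_on[OF assms(1)] by simp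
next
  case (Suc k)
  show ?case
  proof (rule Ck_on_SucI[OF assms(2)])
    show "((\<lambda>x. B (f x) (g x)) has_derivative
        (\<lambda>v. B (f x) (frechet_derivative g (at x) v) + B (frechet_derivative f (at x) v) (g x)))
        (at x)" if "x \<in> S" for x
      using bounded_bilinear.FDERIV[OF assms(1) Ck_on_Suc_has_derivative[OF Suc.prems(1) that]
          Ck_on_Suc_has_derivative[OF Suc.prems(2) that]] .
    have *: "Ck_on k f S" "Ck_on k g S"
      using Suc.prems Ck_on_SucD by blast+
    show "Ck_on k (\<lambda>x. B (f x) (frechet_derivative g (at x) v)
        + B (frechet_derivative f (at x) v) (g x)) S" for v
      using Suc.prems by (intro Ck_on_add[OF assms(2)] Suc.IH *) auto
  qed
qed

text \<open>Expanding the inner derivative in a basis turns the chain rule into a finite sum of products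
  of a derivative of \<open>g\<close> with a partial derivative of \<open>F\<close> composed with \<open>g\<close>, to which
  the induction hypothesis applies.\<close>

lemma Ck_on_compose:
  fixes g :: "'a::real_normed_vector \<Rightarrow> 'b::euclidean_space"
    and F :: "'b \<Rightarrow> 'c::real_normed_vector"
  assumes "open S" "g ` S \<subseteq> W"
  shows "Ck_on k F W \<Longrightarrow> Ck_on k g S \<Longrightarrow> Ck_on k (\<lambda>x. F (g x)) S"
proof (induction k arbitrary: F)
  case 0
  then show ?case
    using assms continuous_on_compose2 by auto
next
  case (Suc k)
  let ?f' = "\<lambda>x v. \<Sum>b\<in>Basis. (frechet_derivative g (at x) v \<bullet> b) *\<^sub>R frechet_derivative F (at (g x)) b"
  show ?case
  proof (rule Ck_on_SucI[OF assms(1)])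
    show "((\<lambda>x. F (g x)) has_derivative ?f' x) (at x)" if "x \<in> S" for x
    proof -
      have F: "(F has_derivative frechet_derivative F (at (g x))) (at (g x))"
        by (rule Ck_on_Suc_has_derivative[OF Suc.prems(1)]) (use assms that in blast)
      have lin: "linear (frechet_derivative F (at (g x)))"
        using F has_derivative_linear by blast
      have "?f' x v = frechet_derivative F (at (g x)) (frechet_derivative g (at x) v)" for v
        by (subst (2) euclidean_representation[of "frechet_derivative g (at x) v", symmetric])
          (simp add: linear_sum[OF lin] linear_scale[OF lin])
      then show ?thesis
        using has_derivative_compose[OF Ck_on_Suc_has_derivative[OF Suc.prems(2) that] F] by simp
    qed
    have g: "Ck_on k g S"
      using Suc.prems Ck_on_SucD by blast
    show "Ck_on k (\<lambda>x. ?f' x v) S" for v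
      using Suc.prems g
      by (intro Ck_on_sum assms(1) finite_Basis Suc.IH
          Ck_on_bilinear[OF bounded_bilinear_scaleR] Ck_on_linear[OF bounded_linear_inner_left]) auto
  qed
qed

text \<open>The normal field of a surface has only local smooth extensions; this glues the
  conclusions drawn from them.\<close>

lemma Ck_on_local:
  assumes "\<And>x. x \<in> S \<Longrightarrow> \<exists>A. open A \<and> x \<in> A \<and> Ck_on k f A"
  shows "Ck_on k f S"
  using assms
proof (induction k arbitrary: f)
  case 0
  then show ?case
    by (metis Ck_on.simps(1) continuous_at_imp_continuous_on continuous_on_eq_continuous_at)
next
  case (Suc k)
  have "f differentiable (at x)" if "x \<in> S" for x
    using Suc.prems[OF that] by auto
  moreover have "Ck_on k (\<lambda>x. frechet_derivative f (at x) v) S" for v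
    by (rule Suc.IH) (use Suc.prems in fastforce)
  ultimately show ?case
    by simp
qed

lemma vderiv_cong:
  assumes "open S" "x \<in> S" "\<And>y. y \<in> S \<Longrightarrow> f y = g y"
    and "(f has_vector_derivative f') (at x)"
  shows "vderiv g x = f'"
  by (rule vderiv_eqI, rule has_vector_derivative_transform_within_open[OF assms(4,1,2)])
    (use assms(3) in auto)

lemma smooth_on_vderiv:
  assumes "open I" "smooth_on I f"
  shows "smooth_on I (vderiv f)"
  unfolding smooth_on_def
proof
  fix k
  have "Ck_on (Suc k) f I"
    using assms(2) by (simp only: smooth_on_def)
  then have "Ck_on k (\<lambda>x. frechet_derivative f (at x) 1) I"
    by simp
  then show "Ck_on k (vderiv f) I"
    by (rule Ck_on_cong[OF assms(1), rotated])
      (simp add: vderiv_def frechet_derivative_eq_vector_derivative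
        smooth_on_differentiable[OF assms(2)])
qed

lemma smooth_on_antiderivative:
  fixes f g :: "real \<Rightarrow> 'b::real_normed_vector"
  assumes "open I" "smooth_on I g" "\<And>s. s \<in> I \<Longrightarrow> (f has_vector_derivative g s) (at s)"
  shows "smooth_on I f"
  unfolding smooth_on_def
proof
  fix k
  have "Ck_on (Suc k) f I"
  proof (rule Ck_on_SucI[OF assms(1)])
    show "(f has_derivative (\<lambda>v. v *\<^sub>R g s)) (at s)" if "s \<in> I" for s
      using assms(3)[OF that] by (simp add: has_vector_derivative_def)
    show "Ck_on k (\<lambda>s. v *\<^sub>R g s) I" for v
      using assms(2) by (intro Ck_on_linear[OF bounded_linear_scaleR_right assms(1)])
        (simp add: smooth_on_def)
  qed
  then show "Ck_on k f I"
    by (rule Ck_on_SucD)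
qed

lemma bounded_bilinear_cross3: "bounded_bilinear ((\<times>) :: real^3 \<Rightarrow> real^3 \<Rightarrow> real^3)"
  using bilinear_cross bilinear_conv_bounded_bilinear by blast

lemma smooth_on_cross3:
  "open I \<Longrightarrow> smooth_on I f \<Longrightarrow> smooth_on I g \<Longrightarrow> smooth_on I (\<lambda>s. f s \<times> g s)"
  unfolding smooth_on_def by (blast intro: Ck_on_bilinear[OF bounded_bilinear_cross3])

lemmas has_vector_derivative_cross3 =
  bounded_bilinear.has_vector_derivative[OF bounded_bilinear_cross3]

section \<open>Regular curves on the unit sphere\<close>

text \<open>On the unit sphere the position vector is the outward normal, so this is the usual
  geodesic curvature, in a form valid for any regular parametrization.\<close>

definition spherical_geodesic_curvature :: "(real \<Rightarrow> real^3) \<Rightarrow> real \<Rightarrow> real" where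
  "spherical_geodesic_curvature v s =
     ((v s \<times> vderiv v s) \<bullet> vderiv (vderiv v) s) / norm (vderiv v s) ^ 3"

lemma cross3_common_factor: "(a \<times> b) \<times> (a \<times> c) = ((a \<times> b) \<bullet> c) *\<^sub>R (a :: real^3)"
  by (simp add: cross3_simps vec_eq_iff forall_3 algebra_simps)

text \<open>Up to scaling, the left-hand side is the derivative of the normalized vector
  \<open>(a \<times> b) / |b|\<close> when \<open>a\<close>, \<open>b\<close>, \<open>c\<close> are a spherical curve and its first two derivatives. Both sides
  are \<open>a \<times> (b \<times> (c \<times> b))\<close>, expanded from the inside and from the outside.\<close>

lemma cross3_rejection:
  fixes a b c :: "real^3"
  assumes "a \<bullet> b = 0"
  shows "(b \<bullet> b) *\<^sub>R (a \<times> c) - (b \<bullet> c) *\<^sub>R (a \<times> b) = - ((a \<times> b) \<bullet> c) *\<^sub>R b"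
proof -
  have "(b \<bullet> b) *\<^sub>R (a \<times> c) - (b \<bullet> c) *\<^sub>R (a \<times> b) = a \<times> (b \<times> (c \<times> b))"
    by (simp add: Lagrange Cross3.right_diff_distrib cross_mult_right inner_commute)
  also have "\<dots> = (a \<bullet> (c \<times> b)) *\<^sub>R b"
    unfolding Lagrange[of a b "c \<times> b"] using assms by simp
  also have "a \<bullet> (c \<times> b) = - ((a \<times> b) \<bullet> c)"
    by (simp add: cross3_simps algebra_simps)
  finally show ?thesis .
qed

locale spherical_curve =
  fixes I :: "real set" and v :: "real \<Rightarrow> real^3"
  assumes open_I: "open I" and interval_I: "is_interval I" and smooth: "smooth_on I v"
    and unit: "\<And>s. s \<in> I \<Longrightarrow> norm (v s) = 1"
    and regular: "\<And>s. s \<in> I \<Longrightarrow> vderiv v s \<noteq> 0"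
begin

abbreviation "v1 \<equiv> vderiv v"
abbreviation "v2 \<equiv> vderiv v1"
abbreviation "v3 \<equiv> vderiv v2"
abbreviation "k \<equiv> spherical_geodesic_curvature v"
abbreviation "w s \<equiv> (v s \<times> v1 s) \<bullet> v2 s"

definition conormal :: "real \<Rightarrow> real^3" where
  "conormal s = inverse (norm (v1 s)) *\<^sub>R (v s \<times> v1 s)"

lemma smooth1: "smooth_on I v1" and smooth2: "smooth_on I v2"
  using smooth_on_vderiv[OF open_I] smooth by blast+

lemma derivatives:
  assumes "s \<in> I"
  shows "(v has_vector_derivative v1 s) (at s)" "(v1 has_vector_derivative v2 s) (at s)"
    "(v2 has_vector_derivative v3 s) (at s)"
  using assms smooth smooth1 smooth2 by (auto intro: vderiv_works smooth_on_differentiable)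

lemma orth: "s \<in> I \<Longrightarrow> v s \<bullet> v1 s = 0"
  using inner_derivative_of_constant[of v s v I 1] open_I unit smooth smooth_on_differentiable
  by (fastforce simp: norm_eq_1 inner_commute)

lemma norm_cross: "s \<in> I \<Longrightarrow> norm (v s \<times> v1 s) = norm (v1 s)"
  using norm_cross_dot[of "v s" "v1 s"] unit orth by simp

text \<open>This is the Frenet equation of the spherical curve for its conormal. It carries both
  implications between constant angle and constant curvature.\<close>

lemma conormal_derivative:
  assumes "s \<in> I"
  shows "(conormal has_vector_derivative - k s *\<^sub>R v1 s) (at s)"
proof -
  let ?n = "norm (v1 s)"
  have n: "?n > 0" and nn: "v1 s \<bullet> v1 s = ?n ^ 2"
    using regular[OF assms] by (auto simp: power2_norm_eq_inner)
  have "((\<lambda>t. v1 t \<bullet> v1 t) has_real_derivative 2 * (v1 s \<bullet> v2 s)) (at s)"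
    using bounded_bilinear.has_vector_derivative[OF bounded_bilinear_inner derivatives(2)[OF assms] derivatives(2)[OF assms]]
    by (simp add: has_real_derivative_iff_has_vector_derivative inner_commute)
  from DERIV_real_sqrt[THEN DERIV_chain2, OF _ this]
  have "((\<lambda>t. norm (v1 t)) has_real_derivative (v1 s \<bullet> v2 s) / ?n) (at s)"
    using n by (simp add: norm_eq_sqrt_inner[symmetric] field_simps)
  from DERIV_inverse'[OF this]
  have i: "((\<lambda>t. inverse (norm (v1 t))) has_vector_derivative - (v1 s \<bullet> v2 s) / ?n ^ 3) (at s)"
    using n by (simp add: has_real_derivative_iff_has_vector_derivative field_simps power3_eq_cube)
  have c: "((\<lambda>t. v t \<times> v1 t) has_vector_derivative v s \<times> v2 s) (at s)"
    using has_vector_derivative_cross3[OF derivatives(1)[OF assms] derivatives(2)[OF assms]] by simp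
  have "(conormal has_vector_derivative
      inverse ?n *\<^sub>R (v s \<times> v2 s) + (- (v1 s \<bullet> v2 s) / ?n ^ 3) *\<^sub>R (v s \<times> v1 s)) (at s)"
    using bounded_bilinear.has_vector_derivative[OF bounded_bilinear_scaleR i c]
    by (simp add: conormal_def[abs_def])
  moreover have "inverse ?n *\<^sub>R (v s \<times> v2 s) + (- (v1 s \<bullet> v2 s) / ?n ^ 3) *\<^sub>R (v s \<times> v1 s)
      = inverse (?n ^ 3) *\<^sub>R ((v1 s \<bullet> v1 s) *\<^sub>R (v s \<times> v2 s) - (v1 s \<bullet> v2 s) *\<^sub>R (v s \<times> v1 s))"
    using n by (simp add: nn algebra_simps power3_eq_cube power2_eq_square divide_inverse)
  moreover have "\<dots> = - k s *\<^sub>R v1 s"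
    unfolding cross3_rejection[OF orth[OF assms]]
    by (simp add: spherical_geodesic_curvature_def divide_inverse)
  ultimately show ?thesis
    by simp
qed

lemma norm_conormal: "s \<in> I \<Longrightarrow> norm (conormal s) = 1"
  using regular by (simp add: conormal_def norm_cross)

lemma conormal_orth: "conormal s \<bullet> v s = 0"
  by (simp add: conormal_def dot_cross_self)

lemma derivative_zero_constant:
  fixes f :: "real \<Rightarrow> 'a::real_normed_vector"
  assumes "\<And>s. s \<in> I \<Longrightarrow> (f has_vector_derivative 0) (at s)"
  shows "\<exists>c. \<forall>s\<in>I. f s = c"
  using has_vector_derivative_zero_constant[of I f] interval_I assms
  by (metis has_vector_derivative_at_within is_interval_convex)

text \<open>As \<open>d\<close> is orthogonal to \<open>v'\<close>, it lies in the plane of \<open>v\<close> and the conormal. Both of its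
  components there are constant, so differentiating this decomposition of a constant vector
  gives a linear relation that determines the curvature.\<close>

lemma constant_angle_imp_constant_curvature:
  assumes d: "norm d = 1" "\<And>s. s \<in> I \<Longrightarrow> v s \<bullet> d = c"
  shows "\<exists>k0. \<forall>s\<in>I. k s = k0"
proof -
  have vd: "v1 s \<bullet> d = 0" if "s \<in> I" for s
    using inner_derivative_of_constant[of v s "\<lambda>_. d" I c] open_I that d(2)
      smooth_on_differentiable[OF smooth that]
    by (simp add: vderiv_eqI[OF has_vector_derivative_const])
  have "((\<lambda>s. conormal s \<bullet> d) has_vector_derivative 0) (at s)" if "s \<in> I" for s
    using bounded_linear.has_vector_derivative[OF bounded_linear_inner_left[of d]
        conormal_derivative[OF that]] vd[OF that] by simp
  then obtain e where e: "\<And>s. s \<in> I \<Longrightarrow> conormal s \<bullet> d = e"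
    using derivative_zero_constant[of "\<lambda>s. conormal s \<bullet> d"] by blast
  have dec: "c *\<^sub>R v s + e *\<^sub>R conormal s = d" if "s \<in> I" for s
  proof -
    have "v s \<times> conormal s = - inverse (norm (v1 s)) *\<^sub>R v1 s"
      using unit[OF that] orth[OF that]
      by (simp add: conormal_def cross_mult_right Lagrange norm_eq_1)
    then have "d \<bullet> (v s \<times> conormal s) = 0"
      using vd[OF that] by (simp add: inner_commute)
    then show ?thesis
      using orthonormal_frame_expand(2)[of "conormal s" "v s" d] unit[OF that]
        norm_conormal[OF that] conormal_orth[of s] d(2)[OF that] e[OF that]
      by (simp add: inner_commute)
  qed
  have ek: "c = e * k s" if "s \<in> I" for s
  proof -
    have der: "((\<lambda>s. c *\<^sub>R v s + e *\<^sub>R conormal s) has_vector_derivative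
        c *\<^sub>R v1 s + e *\<^sub>R (- k s *\<^sub>R v1 s)) (at s)"
      using derivatives(1)[OF that] conormal_derivative[OF that]
      by (intro has_vector_derivative_add bounded_linear.has_vector_derivative[OF bounded_linear_scaleR_right])
    have "vderiv (\<lambda>_. d) s = c *\<^sub>R v1 s + e *\<^sub>R (- k s *\<^sub>R v1 s)"
      by (rule vderiv_cong[OF open_I that dec der])
    then have "(c - e * k s) *\<^sub>R v1 s = 0"
      by (auto simp: vderiv_eqI[OF has_vector_derivative_const] algebra_simps)
    then show ?thesis
      using regular[OF that] by simp
  qed
  \<comment> \<open>If \<open>e\<close> vanished, then \<open>c = e k\<close> would too, and with them \<open>d\<close>.\<close>
  have "e \<noteq> 0" if "s \<in> I" for s
    using dec[OF that] ek[OF that] d(1) by auto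
  then have "k s = c / e" if "s \<in> I" for s
    using ek that by (metis nonzero_mult_div_cancel_left)
  then show ?thesis
    by blast
qed

text \<open>The axis is the direction of \<open>k0 v + E\<close> with \<open>E\<close> the conormal: its derivative
  \<open>k0 v' - k v'\<close> vanishes.\<close>

lemma constant_curvature_imp_constant_angle:
  assumes k0: "\<And>s. s \<in> I \<Longrightarrow> k s = k0"
  shows "\<exists>d \<theta>. norm d = 1 \<and> (\<forall>s\<in>I. v s \<bullet> d = cos \<theta>)"
proof (cases "I = {}")
  case True
  then show ?thesis
    by (auto intro: exI[of _ "axis 1 1"])
next
  case False
  have "((\<lambda>s. k0 *\<^sub>R v s + conormal s) has_vector_derivative 0) (at s)" if "s \<in> I" for s
    using has_vector_derivative_add[OF bounded_linear.has_vector_derivative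
        [OF bounded_linear_scaleR_right derivatives(1)[OF that]] conormal_derivative[OF that], of k0] k0[OF that]
    by simp
  then obtain a where a: "\<And>s. s \<in> I \<Longrightarrow> k0 *\<^sub>R v s + conormal s = a"
    using derivative_zero_constant[of "\<lambda>s. k0 *\<^sub>R v s + conormal s"] by blast
  have va: "v s \<bullet> a = k0" "a \<noteq> 0" if "s \<in> I" for s
  proof -
    have "v s \<bullet> v s = 1" "conormal s \<bullet> conormal s = 1"
      using unit norm_conormal that by (simp_all add: norm_eq_1)
    then have "v s \<bullet> a = k0" "conormal s \<bullet> a = 1"
      using conormal_orth[of s]
      by (simp_all add: a[OF that, symmetric] inner_add_right inner_commute)
    then show "v s \<bullet> a = k0" "a \<noteq> 0"
      by auto
  qed
  define d where "d = inverse (norm a) *\<^sub>R a"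
  have nd: "norm d = 1"
    using va(2) False by (auto simp: d_def)
  have vd: "v s \<bullet> d = k0 / norm a" if "s \<in> I" for s
    using va(1)[OF that] by (simp add: d_def divide_inverse)
  obtain s where s: "s \<in> I"
    using False by blast
  have "\<bar>v s \<bullet> d\<bar> \<le> 1"
    using Cauchy_Schwarz_ineq2[of "v s" d] unit[OF s] nd by simp
  then have "cos (arccos (k0 / norm a)) = k0 / norm a"
    using vd[OF s] by (intro cos_arccos_abs) simp
  then show ?thesis
    using nd vd by metis
qed

context
  fixes \<beta> assumes \<beta>: "\<And>s. s \<in> I \<Longrightarrow> (\<beta> has_vector_derivative v s \<times> v1 s) (at s)"
begin

lemma primitive_derivatives:
  assumes "s \<in> I"
  shows "vderiv \<beta> s = v s \<times> v1 s" "vderiv (vderiv \<beta>) s = v s \<times> v2 s"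
    "vderiv (vderiv (vderiv \<beta>)) s = v s \<times> v3 s + v1 s \<times> v2 s"
proof -
  have 1: "vderiv \<beta> s = v s \<times> v1 s" if "s \<in> I" for s
    using \<beta>[OF that] by (rule vderiv_eqI)
  have 2: "vderiv (vderiv \<beta>) s = v s \<times> v2 s" if "s \<in> I" for s
    using has_vector_derivative_cross3[OF derivatives(1)[OF that] derivatives(2)[OF that]]
    by (intro vderiv_cong[OF open_I that 1[symmetric]]) auto
  show "vderiv \<beta> s = v s \<times> v1 s" "vderiv (vderiv \<beta>) s = v s \<times> v2 s"
    using 1 2 assms by blast+
  show "vderiv (vderiv (vderiv \<beta>)) s = v s \<times> v3 s + v1 s \<times> v2 s"
    using has_vector_derivative_cross3[OF derivatives(1)[OF assms] derivatives(3)[OF assms]]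
    by (intro vderiv_cong[OF open_I assms 2[symmetric]]) auto
qed

lemma primitive_regular: "regular_curve_on I \<beta>"
proof -
  have "smooth_on I \<beta>"
    using smooth_on_antiderivative[OF open_I smooth_on_cross3[OF open_I smooth smooth1] \<beta>] .
  moreover have "vderiv \<beta> s \<noteq> 0" if "s \<in> I" for s
    using norm_cross[OF that] regular[OF that] primitive_derivatives(1)[OF that] by force
  ultimately show ?thesis
    by (simp add: regular_curve_on_def)
qed

lemma primitive_curvature: "s \<in> I \<Longrightarrow> curvature \<beta> s = \<bar>k s\<bar>"
  by (simp add: curvature_def primitive_derivatives cross3_common_factor unit norm_cross
      spherical_geodesic_curvature_def)

text \<open>With \<open>w = det (v, v', v'')\<close>, the product \<open>\<beta>' \<times> \<beta>''\<close> is \<open>w v\<close>, and the component of \<open>\<beta>'''\<close>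
  along \<open>v\<close> is \<open>w\<close> again. So the torsion is \<open>w\<^sup>2 / w\<^sup>2\<close>.\<close>

lemma primitive_torsion:
  assumes "s \<in> I"
  shows "torsion \<beta> s = (if k s = 0 then 0 else 1)"
proof -
  have "v s \<bullet> (v1 s \<times> v2 s) = w s"
    by (simp add: cross3_simps algebra_simps)
  then have "torsion \<beta> s = (w s)\<^sup>2 / (w s)\<^sup>2"
    using assms unit
    by (simp add: torsion_def primitive_derivatives cross3_common_factor inner_add_right
        dot_cross_self power2_eq_square)
  then show ?thesis
    using regular[OF assms] by (simp add: spherical_geodesic_curvature_def)
qed

lemma continuous_curvature: "continuous_on I k"
proof -
  have "continuous_on I v" "continuous_on I v1" "continuous_on I v2"
    using smooth smooth1 smooth2 unfolding smooth_on_def by (metis Ck_on.simps(1))+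
  then show ?thesis
    unfolding spherical_geodesic_curvature_def[abs_def] using regular
    by (intro continuous_intros bounded_bilinear.continuous_on[OF bounded_bilinear_cross3]) auto
qed

lemma primitive_circular_helix_iff: "circular_helix_on I \<beta> \<longleftrightarrow> (\<exists>k0. \<forall>s\<in>I. k s = k0)"
proof
  assume "circular_helix_on I \<beta>"
  then obtain c where c: "\<And>s. s \<in> I \<Longrightarrow> \<bar>k s\<bar> = c"
    using primitive_curvature unfolding circular_helix_on_def by metis
  \<comment> \<open>The curvature of \<open>\<beta>\<close> loses the sign of \<open>k\<close>; continuity on an interval forbids a change
    of sign.\<close>
  then have "k ` I \<subseteq> {c, - c}"
    by force
  then have "finite (k ` I)"
    by (rule finite_subset) simp
  then have "k constant_on I"
    using continuous_finite_range_constant[OF _ continuous_curvature] interval_I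
    by (simp add: is_interval_connected_1)
  then show "\<exists>k0. \<forall>s\<in>I. k s = k0"
    by (simp add: constant_on_def)
next
  assume "\<exists>k0. \<forall>s\<in>I. k s = k0"
  then show "circular_helix_on I \<beta>"
    unfolding circular_helix_on_def
    using primitive_regular primitive_curvature primitive_torsion by metis
qed

end

end

section \<open>The Darboux frame\<close>

lemma smooth_on_darboux_U:
  assumes "oriented_surface M N" "open I" "smooth_on I \<gamma>" "\<gamma> ` I \<subseteq> M"
  shows "smooth_on I (darboux_U N \<gamma>)"
  unfolding smooth_on_def
proof (intro allI Ck_on_local)
  fix k s assume s: "s \<in> I"
  then have "\<gamma> s \<in> M"
    using assms(4) by blast
  then obtain W F where W: "open W" "\<gamma> s \<in> W" "smooth_on W F" "\<forall>q \<in> M \<inter> W. F q = N q"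
    using assms(1) unfolding oriented_surface_def by meson
  define A where "A = \<gamma> -` W \<inter> I"
  have "continuous_on I \<gamma>"
    using assms(3) unfolding smooth_on_def by (metis Ck_on.simps(1))
  then have A: "open A"
    unfolding A_def using assms(2) W(1) continuous_on_open_vimage by blast
  have \<gamma>: "Ck_on k \<gamma> A"
    by (rule Ck_on_local) (use assms(2,3) in \<open>auto simp: A_def smooth_on_def\<close>)
  have "Ck_on k (\<lambda>t. F (\<gamma> t)) A"
    by (rule Ck_on_compose[OF A _ _ \<gamma>, where W = W])
      (use W(3) in \<open>auto simp: A_def smooth_on_def\<close>)
  then have "Ck_on k (darboux_U N \<gamma>) A"
    by (rule Ck_on_cong[OF A, rotated]) (use W(4) assms(4) in \<open>auto simp: A_def darboux_U_def\<close>)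
  then show "\<exists>A. open A \<and> s \<in> A \<and> Ck_on k (darboux_U N \<gamma>) A"
    using A W(2) s by (auto simp: A_def)
qed

theorem theorem4:
  fixes M :: "(real^3) set" and N :: "real^3 \<Rightarrow> real^3"
    and I :: "real set" and \<gamma> \<beta> :: "real \<Rightarrow> real^3"
  assumes "oriented_surface M N"
    and "open I" and "is_interval I"
    and "regular_curve_on I \<gamma>" and "unit_speed_on I \<gamma>" and "\<gamma> ` I \<subseteq> M"
    and "\<forall>s\<in>I. (\<beta> has_vector_derivative rectifying_darboux N \<gamma> s) (at s)"
    and "\<forall>s\<in>I. rectifying_darboux N \<gamma> s \<noteq> 0"
  shows "relatively_normal_slant_helix I N \<gamma> \<longleftrightarrow> circular_helix_on I \<beta>"
proof -
  let ?T = "darboux_T \<gamma>" and ?U = "darboux_U N \<gamma>" and ?V = "darboux_V N \<gamma>"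
  have sm: "smooth_on I \<gamma>"
    using assms(4) by (simp add: regular_curve_on_def)
  have smV: "smooth_on I ?V"
    unfolding darboux_V_def[abs_def] darboux_T_def
    using smooth_on_cross3 smooth_on_darboux_U smooth_on_vderiv assms(1,2,6) sm by blast
  have frame: "norm (?T s) = 1" "norm (?U s) = 1" "?U s \<bullet> ?T s = 0" if "s \<in> I" for s
  proof -
    show "norm (?T s) = 1"
      using assms(5) that by (simp add: unit_speed_on_def darboux_T_def)
    show "norm (?U s) = 1"
      using assms(1,6) that by (auto simp: oriented_surface_def darboux_U_def)
    have "vderiv \<gamma> s \<in> tangent_plane M (\<gamma> s)"
      using assms(2,3,6) sm that unfolding tangent_plane_def by blast
    then show "?U s \<bullet> ?T s = 0"
      using assms(1,6) that by (auto simp: oriented_surface_def darboux_T_def darboux_U_def)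
  qed
  have Dr: "rectifying_darboux N \<gamma> s = ?V s \<times> vderiv ?V s" if "s \<in> I" for s
  proof -
    have "?V s \<times> ?T s = - ?U s" "?V s \<times> ?U s = ?T s"
      using frame[OF that] unfolding darboux_V_def
      by (simp_all add: cross_skew[of "?U s \<times> ?T s"] Lagrange norm_eq_1 inner_commute)
    moreover have "vderiv ?V s = - geodesic_curvature N \<gamma> s *\<^sub>R ?T s + geodesic_torsion N \<gamma> s *\<^sub>R ?U s"
      using darboux_equations(2)[OF assms(1-6) that] by (rule vderiv_eqI)
    ultimately show ?thesis
      by (simp add: rectifying_darboux_def Cross3.right_diff_distrib cross_mult_right)
  qed
  interpret spherical_curve I ?V
  proof
    show "norm (?V s) = 1" if "s \<in> I" for s
      using orthonormal_frame_expand(1) frame[OF that] by (simp add: darboux_V_def)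
    show "vderiv ?V s \<noteq> 0" if "s \<in> I" for s
      using Dr[OF that] assms(8) that by auto
  qed (use assms smV in auto)
  have "relatively_normal_slant_helix I N \<gamma> \<longleftrightarrow> (\<exists>k0. \<forall>s\<in>I. k s = k0)"
  proof
    assume "relatively_normal_slant_helix I N \<gamma>"
    then obtain d \<theta> where "norm d = 1" "\<And>s. s \<in> I \<Longrightarrow> ?V s \<bullet> d = cos \<theta>"
      unfolding relatively_normal_slant_helix_def by blast
    then show "\<exists>k0. \<forall>s\<in>I. k s = k0"
      by (rule constant_angle_imp_constant_curvature)
  next
    assume "\<exists>k0. \<forall>s\<in>I. k s = k0"
    then show "relatively_normal_slant_helix I N \<gamma>"
      unfolding relatively_normal_slant_helix_def
      using constant_curvature_imp_constant_angle by blast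
  qed
  also have "\<dots> \<longleftrightarrow> circular_helix_on I \<beta>"
    using primitive_circular_helix_iff assms(7) Dr by simp
  finally show ?thesis .
qed

end
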